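(* Let $u$ be a smooth function of one space variable $x$, let $f,S$ be smooth scalar functions and $\nu$ a constant, and set $$F=-\partial_x f(u),\qquad G=\nu u_{xx}+S(u),\qquad H=F+G,$$ $$\dot F=-\partial_x\big(f'(u)H\big),\qquad \dot G=\nu\,\partial_{xx}H+S'(u)H .$$ Let $\Pi_h$ be the grid projection on a grid of spacing $\Delta x$, and assume that the semi-discrete right-hand side $H_h=H_h(\Pi_hu)$ satisfies $$H_h(\Pi_hu)=\Pi_hH(u)+O(\Delta x^p)$$ with a uniformly smooth asymptotic error expansion. Let $D_h^{(m)}$, $m=1,2$, be stable discrete first- and second-derivative operators satisfying, for smooth $\psi$, $$D_h^{(m)}\Pi_h\psi=\Pi_h(\partial_x^m\psi)+O(\Delta x^{r_m}),\qquad m=1,2.$$ Define $$\widehat{\dot F}_h=-D_h^{(1)}\big(f'(\Pi_hu)H_h\big),\qquad \widehat{\dot G}_h=\nu D_h^{(2)}H_h+S'(\Pi_hu)H_h .$$ Then $$\widehat{\dot F}_h=\Pi_h\dot F+O(\Delta x^{q_F}),\quad q_F=\min\{p,r_1\},\qquad \widehat{\dot G}_h=\Pi_h\dot G+O(\Delta x^{q_G}),\quad q_G=\min\{p,r_2\}.$$ The analogous result holds in several space dimensions, where the first- and second-derivative terms are sums over coordinate directions, each discretized by directional operators with the same properties.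
   Context: $\Pi_h$ is sampling of a function at the grid points; products of grid functions, and $f'(\Pi_hu)$, $S'(\Pi_hu)$, are taken pointwise. All $O(\cdot)$ are in a fixed grid norm (for instance the maximum norm) as $\Delta x\to0$. "Uniformly smooth asymptotic error expansion" means $H_h(\Pi_hu)=\Pi_hH+\Delta x^p\,e_h$ where $e_h=\Pi_h\epsilon_{\Delta x}$ is the sampling of functions $\epsilon_{\Delta x}$ whose derivatives (as many as needed) are bounded uniformly in $\Delta x$; in particular $e_h$ and the needed discrete derivatives of $e_h$ and of its products with samples of smooth functions are uniformly bounded. "Stable" means that the linear operators $D_h^{(m)}$ map samplings of uniformly smooth families of functions to uniformly bounded grid functions. $\dot F,\dot G$ are the temporal derivatives of $F,G$ along the complete field $u_t=H$ for the convection–diffusion–reaction equation $u_t+\partial_xf(u)=\nu u_{xx}+S(u)$. *)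

theory Defs
  imports "HOL-Analysis.Analysis"
begin

section \<open>Smooth functions\<close>

definition partial :: "'a::euclidean_space \<Rightarrow> ('a \<Rightarrow> real) \<Rightarrow> 'a \<Rightarrow> real" where
  "partial b \<psi> x = deriv (\<lambda>t. \<psi> (x + t *\<^sub>R b)) 0"

fun partials :: "'a::euclidean_space list \<Rightarrow> ('a \<Rightarrow> real) \<Rightarrow> 'a \<Rightarrow> real" where
  "partials [] \<psi> = \<psi>"
| "partials (b # bs) \<psi> = partial b (partials bs \<psi>)"

lemma partial_real: "partial 1 \<psi> = deriv (\<psi> :: real \<Rightarrow> real)"
proof
  fix x :: real
  have "((\<lambda>t. \<psi> (x + t)) has_field_derivative D) (at 0) \<longleftrightarrow> (\<psi> has_field_derivative D) (at x)" for D
    using DERIV_shift[of \<psi> D 0 x] by (simp add: add.commute)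
  then show "partial 1 \<psi> x = deriv \<psi> x"
    by (simp add: partial_def deriv_def)
qed

definition smooth :: "('a::euclidean_space \<Rightarrow> real) \<Rightarrow> bool" where
  "smooth \<psi> \<longleftrightarrow> (\<forall>bs x. set bs \<subseteq> Basis \<longrightarrow> partials bs \<psi> differentiable (at x))"

definition has_periods :: "'a::euclidean_space set \<Rightarrow> ('a \<Rightarrow> real) \<Rightarrow> bool" where
  "has_periods per \<psi> \<longleftrightarrow> (\<forall>L\<in>per. \<forall>x. \<psi> (x + L) = \<psi> x)"

text \<open>
  The spatial domain is described by a set \<open>\<Omega>\<close> together with a set \<open>per\<close> of
  periods.  The whole space is \<open>\<Omega> = UNIV\<close>, \<open>per = {}\<close>; a compact interval is
  \<open>\<Omega> = {a..b}\<close>, \<open>per = {}\<close>; the periodic interval is \<open>\<Omega> = {0..<L}\<close>, \<open>per = {L}\<close>.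
  Functions are defined on the full space, so that no one-sided derivatives at the
  boundary of \<open>\<Omega>\<close> are needed, but all bounds are imposed on \<open>\<Omega>\<close> only.  For bounded \<open>\<Omega>\<close>
  boundedness of the derivatives is automatic; for unbounded \<open>\<Omega>\<close> it is what makes
  error bounds in a maximum norm meaningful.
\<close>

definition smooth_fun :: "'a::euclidean_space set \<Rightarrow> 'a set \<Rightarrow> ('a \<Rightarrow> real) \<Rightarrow> bool" where
  "smooth_fun \<Omega> per \<psi> \<longleftrightarrow> smooth \<psi> \<and> has_periods per \<psi> \<and>
     (\<forall>bs. set bs \<subseteq> Basis \<longrightarrow> bounded (partials bs \<psi> ` \<Omega>))"

text \<open>
  A family \<open>\<epsilon> h\<close>, \<open>h \<in> hs\<close>, whose derivatives up to order \<open>K\<close> are bounded uniformly in \<open>h\<close>.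
  The order \<open>K\<close> (possibly infinite) makes ``as many derivatives as needed'' explicit.
\<close>

definition uniformly_smooth ::
  "enat \<Rightarrow> real set \<Rightarrow> 'a::euclidean_space set \<Rightarrow> 'a set \<Rightarrow> (real \<Rightarrow> 'a \<Rightarrow> real) \<Rightarrow> bool" where
  "uniformly_smooth K hs \<Omega> per \<epsilon> \<longleftrightarrow>
     (\<forall>h\<in>hs. smooth (\<epsilon> h) \<and> has_periods per (\<epsilon> h)) \<and>
     (\<forall>bs. set bs \<subseteq> Basis \<and> enat (length bs) \<le> K \<longrightarrow>
        (\<exists>C. \<forall>h\<in>hs. \<forall>x\<in>\<Omega>. \<bar>partials bs (\<epsilon> h) x\<bar> \<le> C))"


section \<open>Grids, grid functions and grid norms\<close>

text \<open>
  \<open>hs\<close> is the set of admissible spacings (e.g. \<open>{L / N | N \<ge> 1}\<close>) and \<open>X h\<close> the set of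
  points in \<open>\<Omega>\<close> of a grid with spacing \<open>c b * h\<close> in the coordinate direction \<open>b\<close>.  The origin
  \<open>x0\<close> may depend on \<open>h\<close>, as for cell-centred grids.
\<close>

definition grid_family ::
  "('a::euclidean_space \<Rightarrow> real) \<Rightarrow> real set \<Rightarrow> 'a set \<Rightarrow> (real \<Rightarrow> 'a set) \<Rightarrow> bool" where
  "grid_family c hs \<Omega> X \<longleftrightarrow> (\<forall>b\<in>Basis. c b > 0) \<and> hs \<subseteq> {0<..} \<and> 0 islimpt hs \<and>
     (\<forall>h\<in>hs. \<exists>x0. X h = {x\<in>\<Omega>. \<forall>b\<in>Basis. \<exists>j::int. (x - x0) \<bullet> b = of_int j * (c b * h)})"

text \<open>A grid function on the point set \<open>X\<close> is represented by its extension by zero.\<close>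

definition grid_funs :: "'a set \<Rightarrow> ('a \<Rightarrow> real) set" where
  "grid_funs X = {v. \<forall>x. x \<notin> X \<longrightarrow> v x = 0}"

definition grid_proj :: "'a set \<Rightarrow> ('a \<Rightarrow> real) \<Rightarrow> 'a \<Rightarrow> real" ("\<Pi>") where
  "\<Pi> X \<psi> = (\<lambda>x. if x \<in> X then \<psi> x else 0)"

definition max_norm :: "'a set \<Rightarrow> ('a \<Rightarrow> real) \<Rightarrow> ennreal" where
  "max_norm X v = (SUP x\<in>X. ennreal \<bar>v x\<bar>)"

text \<open>
  A family of norms on the grid functions.  On an infinite grid the norm may take the value
  infinity.  The last condition (control by the maximum norm, uniformly in \<open>h\<close>) expresses that
  samples of uniformly bounded functions are uniformly bounded grid functions; it holds for the
  maximum norm itself and for scaled discrete Lebesgue norms on bounded domains.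
\<close>

definition grid_norm ::
  "real set \<Rightarrow> (real \<Rightarrow> 'a set) \<Rightarrow> (real \<Rightarrow> ('a \<Rightarrow> real) \<Rightarrow> ennreal) \<Rightarrow> bool" where
  "grid_norm hs X N \<longleftrightarrow>
     (\<forall>h\<in>hs. \<forall>v\<in>grid_funs (X h).
        (N h v = 0 \<longleftrightarrow> v = (\<lambda>x. 0)) \<and>
        (\<forall>a. N h (\<lambda>x. a * v x) = ennreal \<bar>a\<bar> * N h v) \<and>
        (\<forall>w\<in>grid_funs (X h). N h (\<lambda>x. v x + w x) \<le> N h v + N h w)) \<and>
     (\<exists>M::real. \<forall>h\<in>hs. \<forall>v\<in>grid_funs (X h). N h v \<le> ennreal M * max_norm (X h) v)"

lemma grid_norm_max_norm: "grid_norm hs X (\<lambda>h. max_norm (X h))"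
proof -
  have zero: "max_norm Y v = 0 \<longleftrightarrow> v = (\<lambda>x. 0)" if "v \<in> grid_funs Y" for Y :: "'a set" and v
    using that by (auto simp: max_norm_def grid_funs_def SUP_eq_iff bot_ennreal[symmetric] fun_eq_iff)
      (auto simp: bot_ennreal)
  have scale: "max_norm Y (\<lambda>x. a * v x) = ennreal \<bar>a\<bar> * max_norm Y v" for Y :: "'a set" and a v
    by (simp add: max_norm_def abs_mult ennreal_mult SUP_mult_left_ennreal)
  have tri: "max_norm Y (\<lambda>x. v x + w x) \<le> max_norm Y v + max_norm Y w" for Y :: "'a set" and v w
    unfolding max_norm_def
  proof (rule SUP_least)
    fix x assume "x \<in> Y"
    have "ennreal \<bar>v x + w x\<bar> \<le> ennreal \<bar>v x\<bar> + ennreal \<bar>w x\<bar>"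
      by (simp add: ennreal_plus[symmetric] del: ennreal_plus)
    also have "\<dots> \<le> (SUP x\<in>Y. ennreal \<bar>v x\<bar>) + (SUP x\<in>Y. ennreal \<bar>w x\<bar>)"
      using \<open>x \<in> Y\<close> by (intro add_mono SUP_upper)
    finally show "ennreal \<bar>v x + w x\<bar> \<le> (SUP x\<in>Y. ennreal \<bar>v x\<bar>) + (SUP x\<in>Y. ennreal \<bar>w x\<bar>)" .
  qed
  show ?thesis
    unfolding grid_norm_def by (auto simp: zero scale tri intro: exI[of _ 1])
qed

text \<open>\<open>v h = w h + O(h powr q)\<close> in the norm \<open>N h\<close>, as \<open>h\<close> tends to 0 through \<open>hs\<close>.\<close>

definition eq_up_to_O ::
  "real set \<Rightarrow> (real \<Rightarrow> ('a \<Rightarrow> real) \<Rightarrow> ennreal) \<Rightarrow>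
   (real \<Rightarrow> 'a \<Rightarrow> real) \<Rightarrow> (real \<Rightarrow> 'a \<Rightarrow> real) \<Rightarrow> real \<Rightarrow> bool" where
  "eq_up_to_O hs N v w q \<longleftrightarrow>
     (\<exists>C. \<forall>\<^sub>F h in at 0 within hs. N h (\<lambda>x. v h x - w h x) \<le> ennreal (C * h powr q))"


section \<open>Discrete operators\<close>

definition grid_linear :: "'a set \<Rightarrow> (('a \<Rightarrow> real) \<Rightarrow> 'a \<Rightarrow> real) \<Rightarrow> bool" where
  "grid_linear X D \<longleftrightarrow>
     (\<forall>v\<in>grid_funs X. D v \<in> grid_funs X) \<and>
     (\<forall>v\<in>grid_funs X. \<forall>w\<in>grid_funs X. D (\<lambda>x. v x + w x) = (\<lambda>x. D v x + D w x)) \<and>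
     (\<forall>v\<in>grid_funs X. \<forall>a. D (\<lambda>x. a * v x) = (\<lambda>x. a * D v x))"

definition stable ::
  "enat \<Rightarrow> real set \<Rightarrow> 'a::euclidean_space set \<Rightarrow> 'a set \<Rightarrow> (real \<Rightarrow> 'a set) \<Rightarrow>
   (real \<Rightarrow> ('a \<Rightarrow> real) \<Rightarrow> ennreal) \<Rightarrow> (real \<Rightarrow> ('a \<Rightarrow> real) \<Rightarrow> 'a \<Rightarrow> real) \<Rightarrow> bool" where
  "stable K hs \<Omega> per X N D \<longleftrightarrow>
     (\<forall>\<epsilon>. uniformly_smooth K hs \<Omega> per \<epsilon> \<longrightarrow>
        (\<exists>C. \<forall>h\<in>hs. N h (D h (\<Pi> (X h) (\<epsilon> h))) \<le> ennreal C))"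

definition consistent ::
  "real set \<Rightarrow> 'a::euclidean_space set \<Rightarrow> 'a set \<Rightarrow> (real \<Rightarrow> 'a set) \<Rightarrow>
   (real \<Rightarrow> ('a \<Rightarrow> real) \<Rightarrow> ennreal) \<Rightarrow> (real \<Rightarrow> ('a \<Rightarrow> real) \<Rightarrow> 'a \<Rightarrow> real) \<Rightarrow>
   (('a \<Rightarrow> real) \<Rightarrow> 'a \<Rightarrow> real) \<Rightarrow> real \<Rightarrow> bool" where
  "consistent hs \<Omega> per X N D L r \<longleftrightarrow>
     (\<forall>\<psi>. smooth_fun \<Omega> per \<psi> \<longrightarrow>
        eq_up_to_O hs N (\<lambda>h. D h (\<Pi> (X h) \<psi>)) (\<lambda>h. \<Pi> (X h) (L \<psi>)) r)"

text \<open>A stable linear discretization of the differential operator \<open>L\<close> of order \<open>r\<close>.\<close>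

definition discretizes ::
  "enat \<Rightarrow> real set \<Rightarrow> 'a::euclidean_space set \<Rightarrow> 'a set \<Rightarrow> (real \<Rightarrow> 'a set) \<Rightarrow>
   (real \<Rightarrow> ('a \<Rightarrow> real) \<Rightarrow> ennreal) \<Rightarrow> (real \<Rightarrow> ('a \<Rightarrow> real) \<Rightarrow> 'a \<Rightarrow> real) \<Rightarrow>
   (('a \<Rightarrow> real) \<Rightarrow> 'a \<Rightarrow> real) \<Rightarrow> real \<Rightarrow> bool" where
  "discretizes K hs \<Omega> per X N D L r \<longleftrightarrow>
     (\<forall>h\<in>hs. grid_linear (X h) (D h)) \<and> stable K hs \<Omega> per X N D \<and>
     consistent hs \<Omega> per X N D L r"

text \<open>
  \<open>Hh h\<close> is a (generally nonlinear) map of grid functions whose value at \<open>\<Pi> (X h) u\<close> has a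
  uniformly smooth asymptotic error expansion of order \<open>p\<close> about the sample of \<open>H\<close>.
\<close>

definition has_error_expansion ::
  "enat \<Rightarrow> real set \<Rightarrow> 'a::euclidean_space set \<Rightarrow> 'a set \<Rightarrow> (real \<Rightarrow> 'a set) \<Rightarrow>
   (real \<Rightarrow> ('a \<Rightarrow> real) \<Rightarrow> 'a \<Rightarrow> real) \<Rightarrow> ('a \<Rightarrow> real) \<Rightarrow> ('a \<Rightarrow> real) \<Rightarrow> real \<Rightarrow> bool" where
  "has_error_expansion K hs \<Omega> per X Hh u H p \<longleftrightarrow>
     (\<forall>h\<in>hs. \<forall>v\<in>grid_funs (X h). Hh h v \<in> grid_funs (X h)) \<and>
     (\<exists>\<epsilon>. uniformly_smooth K hs \<Omega> per \<epsilon> \<and>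
        (\<forall>h\<in>hs. Hh h (\<Pi> (X h) u) = (\<lambda>x. \<Pi> (X h) H x + h powr p * \<Pi> (X h) (\<epsilon> h) x)))"


section \<open>The convection--diffusion--reaction equation in one space dimension\<close>

definition F1 :: "(real \<Rightarrow> real) \<Rightarrow> (real \<Rightarrow> real) \<Rightarrow> real \<Rightarrow> real" where
  "F1 f u = (\<lambda>x. - deriv (\<lambda>y. f (u y)) x)"

definition G1 :: "real \<Rightarrow> (real \<Rightarrow> real) \<Rightarrow> (real \<Rightarrow> real) \<Rightarrow> real \<Rightarrow> real" where
  "G1 \<nu> S u = (\<lambda>x. \<nu> * (deriv ^^ 2) u x + S (u x))"

definition H1 :: "(real \<Rightarrow> real) \<Rightarrow> real \<Rightarrow> (real \<Rightarrow> real) \<Rightarrow> (real \<Rightarrow> real) \<Rightarrow> real \<Rightarrow> real" where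
  "H1 f \<nu> S u = (\<lambda>x. F1 f u x + G1 \<nu> S u x)"

definition F1_dot :: "(real \<Rightarrow> real) \<Rightarrow> real \<Rightarrow> (real \<Rightarrow> real) \<Rightarrow> (real \<Rightarrow> real) \<Rightarrow> real \<Rightarrow> real" where
  "F1_dot f \<nu> S u = (\<lambda>x. - deriv (\<lambda>y. deriv f (u y) * H1 f \<nu> S u y) x)"

definition G1_dot :: "(real \<Rightarrow> real) \<Rightarrow> real \<Rightarrow> (real \<Rightarrow> real) \<Rightarrow> (real \<Rightarrow> real) \<Rightarrow> real \<Rightarrow> real" where
  "G1_dot f \<nu> S u =
     (\<lambda>x. \<nu> * (deriv ^^ 2) (H1 f \<nu> S u) x + deriv S (u x) * H1 f \<nu> S u x)"

text \<open>In the discrete versions \<open>U\<close> stands for the sampled \<open>u\<close> and \<open>W\<close> for the grid function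
  \<open>Hh h U\<close>.\<close>

definition F1_dot_h ::
  "((real \<Rightarrow> real) \<Rightarrow> real \<Rightarrow> real) \<Rightarrow> (real \<Rightarrow> real) \<Rightarrow>
   (real \<Rightarrow> real) \<Rightarrow> (real \<Rightarrow> real) \<Rightarrow> real \<Rightarrow> real" where
  "F1_dot_h D f U W = (\<lambda>x. - D (\<lambda>y. deriv f (U y) * W y) x)"

definition G1_dot_h ::
  "((real \<Rightarrow> real) \<Rightarrow> real \<Rightarrow> real) \<Rightarrow> real \<Rightarrow> (real \<Rightarrow> real) \<Rightarrow>
   (real \<Rightarrow> real) \<Rightarrow> (real \<Rightarrow> real) \<Rightarrow> real \<Rightarrow> real" where
  "G1_dot_h D \<nu> S U W = (\<lambda>x. \<nu> * D W x + deriv S (U x) * W x)"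


section \<open>Several space dimensions\<close>

text \<open>The flux has one component \<open>f b\<close> for each coordinate direction \<open>b \<in> Basis\<close>.\<close>

definition Fn :: "('a::euclidean_space \<Rightarrow> real \<Rightarrow> real) \<Rightarrow> ('a \<Rightarrow> real) \<Rightarrow> 'a \<Rightarrow> real" where
  "Fn f u = (\<lambda>x. - (\<Sum>b\<in>Basis. partial b (\<lambda>y. f b (u y)) x))"

definition Gn :: "real \<Rightarrow> (real \<Rightarrow> real) \<Rightarrow> ('a::euclidean_space \<Rightarrow> real) \<Rightarrow> 'a \<Rightarrow> real" where
  "Gn \<nu> S u = (\<lambda>x. \<nu> * (\<Sum>b\<in>Basis. (partial b ^^ 2) u x) + S (u x))"

definition Hn :: "('a::euclidean_space \<Rightarrow> real \<Rightarrow> real) \<Rightarrow> real \<Rightarrow> (real \<Rightarrow> real) \<Rightarrow>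
    ('a \<Rightarrow> real) \<Rightarrow> 'a \<Rightarrow> real" where
  "Hn f \<nu> S u = (\<lambda>x. Fn f u x + Gn \<nu> S u x)"

definition Fn_dot :: "('a::euclidean_space \<Rightarrow> real \<Rightarrow> real) \<Rightarrow> real \<Rightarrow> (real \<Rightarrow> real) \<Rightarrow>
    ('a \<Rightarrow> real) \<Rightarrow> 'a \<Rightarrow> real" where
  "Fn_dot f \<nu> S u =
     (\<lambda>x. - (\<Sum>b\<in>Basis. partial b (\<lambda>y. deriv (f b) (u y) * Hn f \<nu> S u y) x))"

definition Gn_dot :: "('a::euclidean_space \<Rightarrow> real \<Rightarrow> real) \<Rightarrow> real \<Rightarrow> (real \<Rightarrow> real) \<Rightarrow>
    ('a \<Rightarrow> real) \<Rightarrow> 'a \<Rightarrow> real" where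
  "Gn_dot f \<nu> S u =
     (\<lambda>x. \<nu> * (\<Sum>b\<in>Basis. (partial b ^^ 2) (Hn f \<nu> S u) x) + deriv S (u x) * Hn f \<nu> S u x)"

definition Fn_dot_h ::
  "('a::euclidean_space \<Rightarrow> ('a \<Rightarrow> real) \<Rightarrow> 'a \<Rightarrow> real) \<Rightarrow> ('a \<Rightarrow> real \<Rightarrow> real) \<Rightarrow>
   ('a \<Rightarrow> real) \<Rightarrow> ('a \<Rightarrow> real) \<Rightarrow> 'a \<Rightarrow> real" where
  "Fn_dot_h D f U W = (\<lambda>x. - (\<Sum>b\<in>Basis. D b (\<lambda>y. deriv (f b) (U y) * W y) x))"

definition Gn_dot_h ::
  "('a::euclidean_space \<Rightarrow> ('a \<Rightarrow> real) \<Rightarrow> 'a \<Rightarrow> real) \<Rightarrow> real \<Rightarrow> (real \<Rightarrow> real) \<Rightarrow>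
   ('a \<Rightarrow> real) \<Rightarrow> ('a \<Rightarrow> real) \<Rightarrow> 'a \<Rightarrow> real" where
  "Gn_dot_h D \<nu> S U W = (\<lambda>x. \<nu> * (\<Sum>b\<in>Basis. D b W x) + deriv S (U x) * W x)"

end

(*
  Writing H_h = Pi_h H + h^p Pi_h eps_h, linearity turns D_h applied to g(u) H_h into
  D_h Pi_h (g(u) H) + h^p D_h Pi_h (g(u) eps_h). Consistency of D_h controls the first term and
  stability the second, because g(u) eps_h is again a uniformly smooth family: this is the Leibniz
  rule together with the chain rule. Undifferentiated terms are the case where D_h is the identity.
*)
theory Submission
  imports Defs
begin

section \<open>Calculus of smooth families\<close>

text \<open>A typical \<open>m\<close>-th difference quotient of a grid function that is merely
  O(h^p) can be as large as h^(p-m). The full order survives because the error is a scalar multiple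
  of a sample, and for this reason stability speaks only about samples of uniformly smooth families.
  The obstacle is then that multiplication by \<open>deriv g (u x)\<close> must preserve the bounds
  at the very order \<open>K\<close>, possibly finite, at which stability is assumed, while
  smoothness is kept to all orders; hence derivatives are counted order by order. The coefficient
  functions come without any global bounds: those are recovered from compactness, since
  \<open>u\<close> takes its values on \<Omega> in a bounded set. The minimum of the orders appears
  because for 0 < h \<le> 1 a power of \<open>h\<close> may be replaced by any smaller one. The
  estimates are carried out once, for directional operators; the line is the case
  \<open>Basis = {1}\<close>.\<close>

text \<open>\<open>deriv\<close> is total, so \<open>partial\<close> has meaning only where the
  restriction to a line is differentiable. Frechet differentiability provides this for all
  directions at once, with no condition on \<open>b\<close>.\<close>

lemma has_real_derivative_partial:
  assumes "\<psi> differentiable (at x)"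
  shows "((\<lambda>t. \<psi> (x + t *\<^sub>R b)) has_real_derivative partial b \<psi> x) (at 0)"
proof -
  have "(\<psi> \<circ> (\<lambda>t. x + t *\<^sub>R b)) differentiable (at (0::real))"
    using assms by (intro differentiable_chain_at derivative_intros) auto
  then show ?thesis
    unfolding partial_def o_def
    by (metis DERIV_imp_deriv real_differentiable_def)
qed

lemma partial_eqI:
  assumes "((\<lambda>t. \<psi> (x + t *\<^sub>R b)) has_real_derivative D) (at 0)"
  shows "partial b \<psi> x = D"
  using assms by (simp add: partial_def DERIV_imp_deriv)

lemma partial_const: "partial b (\<lambda>x. a) = (\<lambda>x. 0)"
  by (intro ext partial_eqI DERIV_const)

lemma partial_add:
  assumes "\<And>x. \<psi> differentiable (at x)" "\<And>x. \<phi> differentiable (at x)"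
  shows "partial b (\<lambda>x. \<psi> x + \<phi> x) = (\<lambda>x. partial b \<psi> x + partial b \<phi> x)"
  using assms by (intro ext partial_eqI DERIV_add has_real_derivative_partial)

lemma partial_mult:
  assumes "\<And>x. \<psi> differentiable (at x)" "\<And>x. \<phi> differentiable (at x)"
  shows "partial b (\<lambda>x. \<psi> x * \<phi> x) = (\<lambda>x. partial b \<psi> x * \<phi> x + \<psi> x * partial b \<phi> x)"
proof (intro ext partial_eqI)
  fix x
  show "((\<lambda>t. \<psi> (x + t *\<^sub>R b) * \<phi> (x + t *\<^sub>R b)) has_real_derivative
      partial b \<psi> x * \<phi> x + \<psi> x * partial b \<phi> x) (at 0)"
    using DERIV_mult[OF has_real_derivative_partial[OF assms(1)] has_real_derivative_partial[OF assms(2)], of x b x b]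
    by (simp add: algebra_simps)
qed

lemma partial_compose:
  assumes "\<And>y. g differentiable (at y)" "\<And>x. \<psi> differentiable (at x)"
  shows "partial b (\<lambda>x. g (\<psi> x)) = (\<lambda>x. deriv g (\<psi> x) * partial b \<psi> x)"
proof (intro ext partial_eqI)
  fix x
  \<comment> \<open>The base point is written with \<open>0 *\<^sub>R b\<close> because the chain
    rule evaluates the inner function at t = 0.\<close>
  have "(g has_real_derivative deriv g (\<psi> x)) (at (\<psi> (x + 0 *\<^sub>R b)))"
    using assms(1)[of "\<psi> x"] by (metis DERIV_imp_deriv real_differentiable_def scaleR_zero_left add_0_right)
  from DERIV_chain2[OF this has_real_derivative_partial[OF assms(2)]]
  show "((\<lambda>t. g (\<psi> (x + t *\<^sub>R b))) has_real_derivative deriv g (\<psi> x) * partial b \<psi> x) (at 0)" .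
qed

lemma partials_append: "partials (bs @ cs) \<psi> = partials bs (partials cs \<psi>)"
  by (induction bs) auto

lemma smooth_partials:
  assumes "smooth \<psi>" "set cs \<subseteq> Basis"
  shows "smooth (partials cs \<psi>)"
  using assms by (simp add: smooth_def flip: partials_append)

lemma smooth_differentiable: "smooth \<psi> \<Longrightarrow> \<psi> differentiable (at x)"
  unfolding smooth_def by (drule spec[of _ "[]"]) simp

lemma smooth_deriv: "smooth g \<Longrightarrow> smooth (deriv g)"
  using smooth_partials[of g "[1]"] by (simp add: partial_real)

text \<open>
  Smoothness and bounds are tracked up to a finite order: the Leibniz and chain rules express a
  derivative by products of functions about which only lower orders are known. The case
  \<open>\<Omega> = {}\<close> is pure differentiability.
\<close>

definition bounded_derivs :: "nat \<Rightarrow> 'i set \<Rightarrow> 'a::euclidean_space set \<Rightarrow> ('i \<Rightarrow> 'a \<Rightarrow> real) \<Rightarrow> bool" where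
  "bounded_derivs n I \<Omega> \<epsilon> \<longleftrightarrow>
     (\<forall>bs. set bs \<subseteq> Basis \<and> length bs \<le> n \<longrightarrow>
        (\<forall>h\<in>I. \<forall>x. partials bs (\<epsilon> h) differentiable (at x)) \<and>
        (\<exists>C. \<forall>h\<in>I. \<forall>x\<in>\<Omega>. \<bar>partials bs (\<epsilon> h) x\<bar> \<le> C))"

text \<open>The differentiation rules are equations between functions that are available only for
  members of the family, hence the restriction to \<open>h \<in> I\<close>.\<close>

lemma bounded_derivs_cong:
  "(\<And>h. h \<in> I \<Longrightarrow> \<epsilon> h = \<delta> h) \<Longrightarrow> bounded_derivs n I \<Omega> \<epsilon> = bounded_derivs n I \<Omega> \<delta>"
  by (simp add: bounded_derivs_def)

lemma bounded_derivs_mono: "bounded_derivs n I \<Omega> \<epsilon> \<Longrightarrow> m \<le> n \<Longrightarrow> bounded_derivs m I \<Omega> \<epsilon>"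
  unfolding bounded_derivs_def by (meson order_trans)

lemma bounded_derivs_0:
  "bounded_derivs 0 I \<Omega> \<epsilon> \<longleftrightarrow>
     (\<forall>h\<in>I. \<forall>x. \<epsilon> h differentiable (at x)) \<and> (\<exists>C. \<forall>h\<in>I. \<forall>x\<in>\<Omega>. \<bar>\<epsilon> h x\<bar> \<le> C)"
  by (auto simp: bounded_derivs_def)

text \<open>The recursion of \<open>partials\<close> removes the outermost derivative; here the
  innermost one, the last list entry, is split off. It acts directly on the given function, so the
  sum, product and chain rules can rewrite it before the induction hypothesis handles the
  rest.\<close>

lemma bounded_derivs_Suc:
  fixes \<Omega> :: "'a::euclidean_space set"
  shows "bounded_derivs (Suc n) I \<Omega> \<epsilon> \<longleftrightarrow>
     bounded_derivs 0 I \<Omega> \<epsilon> \<and> (\<forall>b\<in>Basis. bounded_derivs n I \<Omega> (\<lambda>h. partial b (\<epsilon> h)))"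
  (is "?L \<longleftrightarrow> ?R")
proof
  assume L: ?L
  have "bounded_derivs n I \<Omega> (\<lambda>h. partial b (\<epsilon> h))" if "b \<in> Basis" for b
    unfolding bounded_derivs_def
  proof (intro allI impI)
    fix bs :: "'a list"
    assume "set bs \<subseteq> Basis \<and> length bs \<le> n"
    with that L[unfolded bounded_derivs_def, rule_format, of "bs @ [b]"]
    show "(\<forall>h\<in>I. \<forall>x. partials bs (partial b (\<epsilon> h)) differentiable (at x)) \<and>
        (\<exists>C. \<forall>h\<in>I. \<forall>x\<in>\<Omega>. \<bar>partials bs (partial b (\<epsilon> h)) x\<bar> \<le> C)"
      by (simp add: partials_append)
  qed
  with L show ?R
    using bounded_derivs_mono by blast
next
  assume R: ?R
  show ?L
    unfolding bounded_derivs_def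
  proof (intro allI impI)
    fix bs :: "'a list"
    assume bs: "set bs \<subseteq> Basis \<and> length bs \<le> Suc n"
    show "(\<forall>h\<in>I. \<forall>x. partials bs (\<epsilon> h) differentiable (at x)) \<and>
        (\<exists>C. \<forall>h\<in>I. \<forall>x\<in>\<Omega>. \<bar>partials bs (\<epsilon> h) x\<bar> \<le> C)"
    proof (cases bs rule: rev_cases)
      case Nil
      with R show ?thesis
        by (simp add: bounded_derivs_0)
    next
      case (snoc cs b)
      with bs R have "bounded_derivs n I \<Omega> (\<lambda>h. partial b (\<epsilon> h))"
        by simp
      with bs snoc show ?thesis
        unfolding bounded_derivs_def by (simp add: partials_append)
    qed
  qed
qed

section \<open>Sums, products and compositions at a fixed order of differentiation\<close>

lemma bounded_derivs_const: "bounded_derivs n I \<Omega> (\<lambda>h x. a)"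
proof (induction n arbitrary: a)
  case 0
  then show ?case
    by (auto simp: bounded_derivs_0)
next
  case (Suc n)
  then show ?case
    by (auto simp: bounded_derivs_Suc[of n] partial_const bounded_derivs_0)
qed

lemma bounded_derivs_add_0:
  assumes "bounded_derivs 0 I \<Omega> \<epsilon>" "bounded_derivs 0 I \<Omega> \<delta>"
  shows "bounded_derivs 0 I \<Omega> (\<lambda>h x. \<epsilon> h x + \<delta> h x)"
proof -
  obtain A B where "\<forall>h\<in>I. \<forall>x\<in>\<Omega>. \<bar>\<epsilon> h x\<bar> \<le> A" "\<forall>h\<in>I. \<forall>x\<in>\<Omega>. \<bar>\<delta> h x\<bar> \<le> B"
    using assms by (auto simp: bounded_derivs_0)
  then have "\<forall>h\<in>I. \<forall>x\<in>\<Omega>. \<bar>\<epsilon> h x + \<delta> h x\<bar> \<le> A + B"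
    by (meson abs_triangle_ineq add_mono order_trans)
  with assms show ?thesis
    by (auto simp: bounded_derivs_0)
qed

lemma bounded_derivs_add:
  assumes "bounded_derivs n I \<Omega> \<epsilon>" "bounded_derivs n I \<Omega> \<delta>"
  shows "bounded_derivs n I \<Omega> (\<lambda>h x. \<epsilon> h x + \<delta> h x)"
  using assms
proof (induction n arbitrary: \<epsilon> \<delta>)
  case 0
  then show ?case
    by (rule bounded_derivs_add_0)
next
  case (Suc n)
  have "bounded_derivs n I \<Omega> (\<lambda>h. partial b (\<lambda>x. \<epsilon> h x + \<delta> h x))" if "b \<in> Basis" for b
  proof -
    have "bounded_derivs n I \<Omega> (\<lambda>h x. partial b (\<epsilon> h) x + partial b (\<delta> h) x)"
      using Suc.prems that by (intro Suc.IH) (auto simp: bounded_derivs_Suc)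
    also have "?this \<longleftrightarrow> ?thesis"
      using Suc.prems
      by (intro bounded_derivs_cong partial_add[symmetric]) (auto simp: bounded_derivs_Suc bounded_derivs_0)
    finally show ?thesis .
  qed
  with Suc.prems show ?case
    by (auto simp: bounded_derivs_Suc intro: bounded_derivs_add_0)
qed

lemma bounded_derivs_mult_0:
  assumes "bounded_derivs 0 I \<Omega> \<epsilon>" "bounded_derivs 0 I \<Omega> \<delta>"
  shows "bounded_derivs 0 I \<Omega> (\<lambda>h x. \<epsilon> h x * \<delta> h x)"
proof -
  obtain A B where "\<forall>h\<in>I. \<forall>x\<in>\<Omega>. \<bar>\<epsilon> h x\<bar> \<le> A" "\<forall>h\<in>I. \<forall>x\<in>\<Omega>. \<bar>\<delta> h x\<bar> \<le> B"
    using assms by (auto simp: bounded_derivs_0)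
  then have "\<forall>h\<in>I. \<forall>x\<in>\<Omega>. \<bar>\<epsilon> h x * \<delta> h x\<bar> \<le> A * B"
    unfolding abs_mult by (meson abs_ge_zero mult_mono order_trans)
  with assms show ?thesis
    by (auto simp: bounded_derivs_0)
qed

lemma bounded_derivs_mult:
  assumes "bounded_derivs n I \<Omega> \<epsilon>" "bounded_derivs n I \<Omega> \<delta>"
  shows "bounded_derivs n I \<Omega> (\<lambda>h x. \<epsilon> h x * \<delta> h x)"
  using assms
proof (induction n arbitrary: \<epsilon> \<delta>)
  case 0
  then show ?case
    by (rule bounded_derivs_mult_0)
next
  case (Suc n)
  \<comment> \<open>Each Leibniz term keeps one factor undifferentiated; its bounds are weakened to
    the order \<open>n\<close> of the other factor, so that the induction hypothesis covers the
    product.\<close>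
  then have low: "bounded_derivs n I \<Omega> \<epsilon>" "bounded_derivs n I \<Omega> \<delta>"
    by (auto intro: bounded_derivs_mono)
  have "bounded_derivs n I \<Omega> (\<lambda>h. partial b (\<lambda>x. \<epsilon> h x * \<delta> h x))" if "b \<in> Basis" for b
  proof -
    have "bounded_derivs n I \<Omega> (\<lambda>h x. partial b (\<epsilon> h) x * \<delta> h x + \<epsilon> h x * partial b (\<delta> h) x)"
      using Suc.prems that low by (intro bounded_derivs_add Suc.IH) (auto simp: bounded_derivs_Suc)
    also have "?this \<longleftrightarrow> ?thesis"
      using Suc.prems
      by (intro bounded_derivs_cong partial_mult[symmetric]) (auto simp: bounded_derivs_Suc bounded_derivs_0)
    finally show ?thesis .
  qed
  with Suc.prems show ?case
    by (auto simp: bounded_derivs_Suc intro: bounded_derivs_mult_0)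
qed

text \<open>A single compact interval \<open>{-A..A}\<close> contains the values of all members of
  the family on \<Omega>, so the bound of the continuous \<open>g\<close> on it is uniform in
  \<open>h\<close>.\<close>

lemma bounded_derivs_compose_0:
  fixes g :: "real \<Rightarrow> real"
  assumes g: "\<And>y. g differentiable (at y)" and \<epsilon>: "bounded_derivs 0 I \<Omega> \<epsilon>"
  shows "bounded_derivs 0 I \<Omega> (\<lambda>h x. g (\<epsilon> h x))"
proof -
  obtain A where A: "\<forall>h\<in>I. \<forall>x\<in>\<Omega>. \<bar>\<epsilon> h x\<bar> \<le> A"
    using \<epsilon> by (auto simp: bounded_derivs_0)
  have "continuous_on {-A..A} g"
    using g by (meson continuous_at_imp_continuous_on differentiable_imp_continuous_within)
  then have "bounded (g ` {-A..A})"
    by (intro compact_imp_bounded compact_continuous_image) auto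
  then obtain B where "\<And>y. y \<in> {-A..A} \<Longrightarrow> \<bar>g y\<bar> \<le> B"
    unfolding bounded_iff by (metis imageI real_norm_def)
  with A have "\<forall>h\<in>I. \<forall>x\<in>\<Omega>. \<bar>g (\<epsilon> h x)\<bar> \<le> B"
    by (simp add: abs_le_iff minus_le_iff)
  moreover have "(\<lambda>x. g (\<epsilon> h x)) differentiable (at x)" if "h \<in> I" for h x
    using differentiable_chain_at[of "\<epsilon> h" x g] g \<epsilon> that by (simp add: bounded_derivs_0 o_def)
  ultimately show ?thesis
    by (auto simp: bounded_derivs_0)
qed

text \<open>The chain rule replaces the outer function \<open>g\<close> by \<open>deriv g\<close>,
  so the induction generalises over \<open>g\<close>. As \<open>g\<close> is smooth to all orders,
  only the order of the inner family has to be counted.\<close>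

lemma bounded_derivs_compose:
  assumes "smooth g" "bounded_derivs n I \<Omega> \<epsilon>"
  shows "bounded_derivs n I \<Omega> (\<lambda>h x. g (\<epsilon> h x))"
  using assms
proof (induction n arbitrary: g)
  case 0
  then show ?case
    using bounded_derivs_compose_0 smooth_differentiable by blast
next
  case (Suc n)
  have "bounded_derivs n I \<Omega> (\<lambda>h. partial b (\<lambda>x. g (\<epsilon> h x)))" if "b \<in> Basis" for b
  proof -
    have "bounded_derivs n I \<Omega> (\<lambda>h x. deriv g (\<epsilon> h x) * partial b (\<epsilon> h) x)"
    proof (rule bounded_derivs_mult)
      show "bounded_derivs n I \<Omega> (\<lambda>h x. deriv g (\<epsilon> h x))"
        by (rule Suc.IH[OF smooth_deriv[OF Suc.prems(1)] bounded_derivs_mono[OF Suc.prems(2)]]) simp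
      show "bounded_derivs n I \<Omega> (\<lambda>h. partial b (\<epsilon> h))"
        using Suc.prems(2) that by (simp add: bounded_derivs_Suc)
    qed
    also have "?this \<longleftrightarrow> ?thesis"
      using Suc.prems
      by (intro bounded_derivs_cong partial_compose[symmetric])
        (auto simp: bounded_derivs_Suc bounded_derivs_0 intro: smooth_differentiable)
    finally show ?thesis .
  qed
  moreover have "bounded_derivs 0 I \<Omega> (\<lambda>h x. g (\<epsilon> h x))"
    using Suc.prems
    by (intro bounded_derivs_compose_0[of g _ _ \<epsilon>] smooth_differentiable) (simp_all add: bounded_derivs_Suc)
  ultimately show ?case
    by (simp add: bounded_derivs_Suc)
qed

text \<open>Smoothness to all orders and bounds up to order \<open>K\<close> become two instances of
  one predicate, the former with empty \<Omega>, where the bounds are vacuous. A closure rule at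
  fixed order thus serves both.\<close>

lemma uniformly_smooth_iff:
  fixes \<Omega> :: "'a::euclidean_space set"
  shows "uniformly_smooth K hs \<Omega> per \<epsilon> \<longleftrightarrow>
     (\<forall>h\<in>hs. has_periods per (\<epsilon> h)) \<and> (\<forall>n. bounded_derivs n hs {} \<epsilon>) \<and>
     (\<forall>n. enat n \<le> K \<longrightarrow> bounded_derivs n hs \<Omega> \<epsilon>)"
proof -
  have smooth: "(\<forall>h\<in>hs. smooth (\<epsilon> h)) \<longleftrightarrow> (\<forall>n. bounded_derivs n hs {} \<epsilon>)"
    unfolding smooth_def bounded_derivs_def by auto
  have bounds: "(\<forall>n. enat n \<le> K \<longrightarrow> bounded_derivs n hs \<Omega> \<epsilon>) \<longleftrightarrow>
      (\<forall>bs. set bs \<subseteq> Basis \<and> enat (length bs) \<le> K \<longrightarrow>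
        (\<exists>C. \<forall>h\<in>hs. \<forall>x\<in>\<Omega>. \<bar>partials bs (\<epsilon> h) x\<bar> \<le> C))" (is "?L \<longleftrightarrow> ?R")
    if "\<forall>h\<in>hs. smooth (\<epsilon> h)"
  proof
    assume ?L
    then show ?R
      unfolding bounded_derivs_def by blast
  next
    assume R: ?R
    have "enat (length bs) \<le> K" if "enat n \<le> K" "length bs \<le> n" for n and bs :: "'a list"
      using that by (meson enat_ord_simps(1) order_trans)
    with R that show ?L
      unfolding bounded_derivs_def smooth_def by blast
  qed
  show ?thesis
    unfolding uniformly_smooth_def using smooth bounds by blast
qed

text \<open>One function is a family over a one-point index set; the index 0 is arbitrary. Closure
  rules for smooth functions become instances of those for families.\<close>

lemma smooth_fun_iff_uniformly_smooth:
  "smooth_fun \<Omega> per \<psi> \<longleftrightarrow> uniformly_smooth \<infinity> {0} \<Omega> per (\<lambda>_. \<psi>)"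
  unfolding smooth_fun_def uniformly_smooth_def bounded_iff by auto

text \<open>This admits the \<open>h\<close>-independent coefficient \<open>deriv g (u x)\<close> as
  a factor of the error family.\<close>

lemma uniformly_smooth_const_family:
  assumes "smooth_fun \<Omega> per \<psi>"
  shows "uniformly_smooth K hs \<Omega> per (\<lambda>_. \<psi>)"
proof -
  have "\<exists>C. \<forall>x\<in>\<Omega>. \<bar>partials bs \<psi> x\<bar> \<le> C" if "set bs \<subseteq> Basis" for bs
    using assms that by (auto simp: smooth_fun_def bounded_iff)
  with assms show ?thesis
    unfolding smooth_fun_def uniformly_smooth_def by blast
qed

section \<open>Closure properties of uniformly smooth families and smooth functions\<close>

lemma uniformly_smooth_mult:
  assumes "uniformly_smooth K hs \<Omega> per \<epsilon>" "uniformly_smooth K hs \<Omega> per \<delta>"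
  shows "uniformly_smooth K hs \<Omega> per (\<lambda>h x. \<epsilon> h x * \<delta> h x)"
  using assms by (auto simp: uniformly_smooth_iff has_periods_def intro: bounded_derivs_mult)

lemma smooth_fun_const: "smooth_fun \<Omega> per (\<lambda>x. a)"
  by (simp add: smooth_fun_iff_uniformly_smooth uniformly_smooth_iff has_periods_def bounded_derivs_const)

lemma smooth_fun_add:
  "smooth_fun \<Omega> per \<psi> \<Longrightarrow> smooth_fun \<Omega> per \<phi> \<Longrightarrow> smooth_fun \<Omega> per (\<lambda>x. \<psi> x + \<phi> x)"
  by (auto simp: smooth_fun_iff_uniformly_smooth uniformly_smooth_iff has_periods_def intro: bounded_derivs_add)

lemma smooth_fun_mult:
  "smooth_fun \<Omega> per \<psi> \<Longrightarrow> smooth_fun \<Omega> per \<phi> \<Longrightarrow> smooth_fun \<Omega> per (\<lambda>x. \<psi> x * \<phi> x)"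
  by (auto simp: smooth_fun_iff_uniformly_smooth intro: uniformly_smooth_mult)

lemma smooth_fun_minus: "smooth_fun \<Omega> per \<psi> \<Longrightarrow> smooth_fun \<Omega> per (\<lambda>x. - \<psi> x)"
  using smooth_fun_mult[OF smooth_fun_const[of _ _ "-1"]] by simp

lemma smooth_fun_sum:
  assumes "\<And>b. b \<in> B \<Longrightarrow> smooth_fun \<Omega> per (\<psi> b)"
  shows "smooth_fun \<Omega> per (\<lambda>x. \<Sum>b\<in>B. \<psi> b x)"
  using assms by (induction B rule: infinite_finite_induct) (auto intro: smooth_fun_const smooth_fun_add)

lemma smooth_fun_compose:
  "smooth g \<Longrightarrow> smooth_fun \<Omega> per \<psi> \<Longrightarrow> smooth_fun \<Omega> per (\<lambda>x. g (\<psi> x))"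
  by (simp add: smooth_fun_iff_uniformly_smooth uniformly_smooth_iff has_periods_def
      bounded_derivs_compose[of g _ _ _ "\<lambda>_. \<psi>"])

lemma has_periods_partial:
  assumes "has_periods per \<psi>"
  shows "has_periods per (partial b \<psi>)"
proof -
  have "\<psi> (x + L + t *\<^sub>R b) = \<psi> (x + t *\<^sub>R b)" if "L \<in> per" for L x t
    using assms that unfolding has_periods_def by (metis add.assoc add.commute)
  then show ?thesis
    by (simp add: has_periods_def partial_def)
qed

text \<open>No order is lost because \<open>smooth_fun\<close> bounds all orders: the derivatives of
  \<open>partial b \<psi>\<close> along \<open>bs\<close> are those of \<open>\<psi>\<close> along
  \<open>bs @ [b]\<close>.\<close>

lemma smooth_fun_partial:
  assumes "b \<in> Basis" "smooth_fun \<Omega> per \<psi>"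
  shows "smooth_fun \<Omega> per (partial b \<psi>)"
proof -
  have "bounded (partials bs (partial b \<psi>) ` \<Omega>)" if "set bs \<subseteq> Basis" for bs
  proof -
    have "set (bs @ [b]) \<subseteq> Basis"
      using that assms(1) by simp
    then have "bounded (partials (bs @ [b]) \<psi> ` \<Omega>)"
      using assms(2) unfolding smooth_fun_def by blast
    then show ?thesis
      by (simp add: partials_append)
  qed
  then show ?thesis
    using assms smooth_partials[of \<psi> "[b]"] by (simp add: smooth_fun_def has_periods_partial)
qed

text \<open>Consistency is assumed for smooth functions only, so the exact right-hand side must be
  an admissible argument of the discrete operators.\<close>

lemma smooth_fun_Hn:
  assumes "smooth_fun \<Omega> per u" "\<forall>b\<in>Basis. smooth (f b)" "smooth S"
  shows "smooth_fun \<Omega> per (Hn f \<nu> S u)"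
proof -
  have "smooth_fun \<Omega> per (partial b (\<lambda>x. f b (u x)))" if "b \<in> Basis" for b
    using assms that by (intro smooth_fun_partial smooth_fun_compose[of "f b" _ _ u]) auto
  moreover have "smooth_fun \<Omega> per ((partial b ^^ 2) u)" if "b \<in> Basis" for b
    using assms(1) that by (simp add: numeral_2_eq_2 smooth_fun_partial)
  moreover have "smooth_fun \<Omega> per (\<lambda>x. S (u x))"
    using assms by (intro smooth_fun_compose[of S _ _ u])
  ultimately show ?thesis
    unfolding Hn_def Fn_def Gn_def
    by (intro smooth_fun_add smooth_fun_minus smooth_fun_mult smooth_fun_const smooth_fun_sum) simp_all
qed


section \<open>Error estimates in a grid norm\<close>

lemma grid_norm_triangle:
  assumes "grid_norm hs X N" "h \<in> hs" "v \<in> grid_funs (X h)" "w \<in> grid_funs (X h)"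
  shows "N h (\<lambda>x. v x + w x) \<le> N h v + N h w"
  using assms unfolding grid_norm_def by simp

lemma grid_norm_scale:
  assumes "grid_norm hs X N" "h \<in> hs" "v \<in> grid_funs (X h)"
  shows "N h (\<lambda>x. a * v x) = ennreal \<bar>a\<bar> * N h v"
  using assms unfolding grid_norm_def by simp

lemma grid_linear_combination:
  assumes D: "grid_linear Y D" and vw: "v \<in> grid_funs Y" "w \<in> grid_funs Y"
  shows "D (\<lambda>x. v x + a * w x) = (\<lambda>x. D v x + a * D w x)"
proof -
  have "(\<lambda>x. a * w x) \<in> grid_funs Y"
    using vw by (simp add: grid_funs_def)
  then have "D (\<lambda>x. v x + a * w x) = (\<lambda>x. D v x + D (\<lambda>x. a * w x) x)"
    using D vw(1) unfolding grid_linear_def by (elim conjE) (drule (1) bspec)+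
  also have "D (\<lambda>x. a * w x) = (\<lambda>x. a * D w x)"
    using D vw(2) unfolding grid_linear_def by simp
  finally show ?thesis .
qed

text \<open>The bound \<open>h \<le> 1\<close> is what makes \<open>h powr q\<close> antitone in
  \<open>q\<close>; the other asymptotic arguments only use \<open>h \<in> hs\<close>.\<close>

lemma eventually_at_within_small:
  fixes hs :: "real set"
  assumes "hs \<subseteq> {0<..}" "\<And>h. h \<in> hs \<Longrightarrow> 0 < h \<Longrightarrow> h \<le> 1 \<Longrightarrow> P h"
  shows "\<forall>\<^sub>F h in at 0 within hs. P h"
  unfolding eventually_at using assms by (intro exI[of _ 1]) (force simp: dist_real_def)

section \<open>Calculus of the relation \<open>eq_up_to_O\<close>\<close>

lemma eq_up_to_O_cong:
  assumes "hs \<subseteq> {0<..}" "\<And>h. h \<in> hs \<Longrightarrow> v h = v' h" "\<And>h. h \<in> hs \<Longrightarrow> w h = w' h"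
  shows "eq_up_to_O hs N v w q \<longleftrightarrow> eq_up_to_O hs N v' w' q"
proof -
  have "\<forall>\<^sub>F h in at 0 within hs. v h = v' h \<and> w h = w' h"
    using assms by (intro eventually_at_within_small) auto
  then have "(\<forall>\<^sub>F h in at 0 within hs. N h (\<lambda>x. v h x - w h x) \<le> ennreal (C * h powr q)) \<longleftrightarrow>
      (\<forall>\<^sub>F h in at 0 within hs. N h (\<lambda>x. v' h x - w' h x) \<le> ennreal (C * h powr q))" for C
    by (intro eventually_subst) (auto elim!: eventually_mono)
  then show ?thesis
    unfolding eq_up_to_O_def by simp
qed

lemma eq_up_to_O_mono:
  assumes hs: "hs \<subseteq> {0<..}" and vw: "eq_up_to_O hs N v w q" and "q' \<le> q"
  shows "eq_up_to_O hs N v w q'"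
proof -
  obtain C where C: "\<forall>\<^sub>F h in at 0 within hs. N h (\<lambda>x. v h x - w h x) \<le> ennreal (C * h powr q)"
    using vw by (auto simp: eq_up_to_O_def)
  \<comment> \<open>The constant may be negative, and then lowering the exponent would decrease the
    bound; the absolute value repairs this.\<close>
  have "\<forall>\<^sub>F h in at 0 within hs. C * h powr q \<le> \<bar>C\<bar> * h powr q'"
    using hs
  proof (rule eventually_at_within_small)
    fix h :: real
    assume h: "0 < h" "h \<le> 1"
    have "C * h powr q \<le> \<bar>C\<bar> * h powr q"
      by (intro mult_right_mono) auto
    also have "\<dots> \<le> \<bar>C\<bar> * h powr q'"
      using h \<open>q' \<le> q\<close> by (intro mult_left_mono powr_mono') auto
    finally show "C * h powr q \<le> \<bar>C\<bar> * h powr q'" .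
  qed
  with C have "\<forall>\<^sub>F h in at 0 within hs. N h (\<lambda>x. v h x - w h x) \<le> ennreal (\<bar>C\<bar> * h powr q')"
    by eventually_elim (meson ennreal_leI order_trans)
  then show ?thesis
    unfolding eq_up_to_O_def by blast
qed

lemma eq_up_to_O_add:
  assumes N: "grid_norm hs X N" and hs: "hs \<subseteq> {0<..}"
    and vw: "eq_up_to_O hs N v w q" "eq_up_to_O hs N v' w' q"
    and grid: "\<And>h. h \<in> hs \<Longrightarrow> v h \<in> grid_funs (X h)" "\<And>h. h \<in> hs \<Longrightarrow> w h \<in> grid_funs (X h)"
      "\<And>h. h \<in> hs \<Longrightarrow> v' h \<in> grid_funs (X h)" "\<And>h. h \<in> hs \<Longrightarrow> w' h \<in> grid_funs (X h)"
  shows "eq_up_to_O hs N (\<lambda>h x. v h x + v' h x) (\<lambda>h x. w h x + w' h x) q"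
proof -
  obtain A B where
    A: "\<forall>\<^sub>F h in at 0 within hs. N h (\<lambda>x. v h x - w h x) \<le> ennreal (A * h powr q)" and
    B: "\<forall>\<^sub>F h in at 0 within hs. N h (\<lambda>x. v' h x - w' h x) \<le> ennreal (B * h powr q)"
    using vw by (auto simp: eq_up_to_O_def)
  have tri: "N h (\<lambda>x. (v h x - w h x) + (v' h x - w' h x)) \<le>
      N h (\<lambda>x. v h x - w h x) + N h (\<lambda>x. v' h x - w' h x)" if "h \<in> hs" for h
  proof -
    have "(\<lambda>x. v h x - w h x) \<in> grid_funs (X h)" "(\<lambda>x. v' h x - w' h x) \<in> grid_funs (X h)"
      using grid[OF that] by (auto simp: grid_funs_def)
    then show ?thesis
      by (rule grid_norm_triangle[OF N that])
  qed
  \<comment> \<open>The norm axioms are available only for admissible spacings, so membership is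
    recovered from the filter.\<close>
  have "\<forall>\<^sub>F h in at 0 within hs. h \<in> hs"
    using hs by (rule eventually_at_within_small)
  with A B have "\<forall>\<^sub>F h in at 0 within hs.
      N h (\<lambda>x. (v h x + v' h x) - (w h x + w' h x)) \<le> ennreal ((\<bar>A\<bar> + \<bar>B\<bar>) * h powr q)"
  proof eventually_elim
    case (elim h)
    have "N h (\<lambda>x. (v h x + v' h x) - (w h x + w' h x)) = N h (\<lambda>x. (v h x - w h x) + (v' h x - w' h x))"
      by (simp add: algebra_simps)
    also have "\<dots> \<le> ennreal (A * h powr q) + ennreal (B * h powr q)"
      using tri[OF elim(3)] elim(1,2) by (meson add_mono order_trans)
    \<comment> \<open>\<open>ennreal\<close> truncates negative numbers to 0 and is additive only on
      nonnegative ones; absolute values precede the merging of the two bounds.\<close>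
    also have "\<dots> \<le> ennreal (\<bar>A\<bar> * h powr q) + ennreal (\<bar>B\<bar> * h powr q)"
      by (intro add_mono ennreal_leI mult_right_mono) auto
    also have "\<dots> = ennreal ((\<bar>A\<bar> + \<bar>B\<bar>) * h powr q)"
      by (simp add: distrib_right flip: ennreal_plus)
    finally show ?case .
  qed
  then show ?thesis
    unfolding eq_up_to_O_def by blast
qed

lemma eq_up_to_O_scale:
  assumes N: "grid_norm hs X N" and hs: "hs \<subseteq> {0<..}" and vw: "eq_up_to_O hs N v w q"
    and grid: "\<And>h. h \<in> hs \<Longrightarrow> v h \<in> grid_funs (X h)" "\<And>h. h \<in> hs \<Longrightarrow> w h \<in> grid_funs (X h)"
  shows "eq_up_to_O hs N (\<lambda>h x. a * v h x) (\<lambda>h x. a * w h x) q"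
proof -
  obtain C where C: "\<forall>\<^sub>F h in at 0 within hs. N h (\<lambda>x. v h x - w h x) \<le> ennreal (C * h powr q)"
    using vw by (auto simp: eq_up_to_O_def)
  have scale: "N h (\<lambda>x. a * (v h x - w h x)) = ennreal \<bar>a\<bar> * N h (\<lambda>x. v h x - w h x)" if "h \<in> hs" for h
  proof -
    have "(\<lambda>x. v h x - w h x) \<in> grid_funs (X h)"
      using grid[OF that] by (auto simp: grid_funs_def)
    then show ?thesis
      by (rule grid_norm_scale[OF N that])
  qed
  have "\<forall>\<^sub>F h in at 0 within hs. h \<in> hs"
    using hs by (rule eventually_at_within_small)
  with C have "\<forall>\<^sub>F h in at 0 within hs. N h (\<lambda>x. a * v h x - a * w h x) \<le> ennreal (\<bar>a\<bar> * C * h powr q)"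
  proof eventually_elim
    case (elim h)
    have "N h (\<lambda>x. a * v h x - a * w h x) = ennreal \<bar>a\<bar> * N h (\<lambda>x. v h x - w h x)"
      using scale[OF elim(2)] by (simp add: right_diff_distrib)
    also have "\<dots> \<le> ennreal \<bar>a\<bar> * ennreal (C * h powr q)"
      using elim(1) by (intro mult_left_mono) auto
    also have "\<dots> = ennreal (\<bar>a\<bar> * C * h powr q)"
      by (simp add: ennreal_mult' mult.assoc)
    finally show ?case .
  qed
  then show ?thesis
    unfolding eq_up_to_O_def by blast
qed

lemma eq_up_to_O_refl:
  assumes N: "grid_norm hs X N" and hs: "hs \<subseteq> {0<..}"
  shows "eq_up_to_O hs N v v q"
proof -
  have "N h (\<lambda>x. 0) = 0" if "h \<in> hs" for h
    using N that unfolding grid_norm_def by (auto simp: grid_funs_def)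
  then show ?thesis
    unfolding eq_up_to_O_def using hs by (intro exI[of _ 0] eventually_at_within_small) auto
qed

lemma eq_up_to_O_sum:
  assumes N: "grid_norm hs X N" and hs: "hs \<subseteq> {0<..}"
    and vw: "\<And>b. b \<in> B \<Longrightarrow> eq_up_to_O hs N (v b) (w b) q"
    and grid: "\<And>b h. b \<in> B \<Longrightarrow> h \<in> hs \<Longrightarrow> v b h \<in> grid_funs (X h)"
      "\<And>b h. b \<in> B \<Longrightarrow> h \<in> hs \<Longrightarrow> w b h \<in> grid_funs (X h)"
  shows "eq_up_to_O hs N (\<lambda>h x. \<Sum>b\<in>B. v b h x) (\<lambda>h x. \<Sum>b\<in>B. w b h x) q"
  using vw grid
proof (induction B rule: infinite_finite_induct)
  case (insert b B)
  have "(\<lambda>x. \<Sum>b\<in>B. v b h x) \<in> grid_funs (X h)" "(\<lambda>x. \<Sum>b\<in>B. w b h x) \<in> grid_funs (X h)" if "h \<in> hs" for h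
    using insert.prems that by (auto simp: grid_funs_def intro!: sum.neutral)
  with insert show ?case
    by (auto intro!: eq_up_to_O_add[OF N hs])
qed (auto intro: eq_up_to_O_refl[OF N hs])


section \<open>Discrete operators applied to a perturbed sample\<close>

lemma grid_proj_in_grid_funs: "\<Pi> Y \<psi> \<in> grid_funs Y"
  by (simp add: grid_proj_def grid_funs_def)

lemma max_norm_grid_proj_le:
  assumes "\<And>x. x \<in> Y \<Longrightarrow> \<bar>\<psi> x\<bar> \<le> C"
  shows "max_norm Y (\<Pi> Y \<psi>) \<le> ennreal C"
  unfolding max_norm_def using assms by (auto simp: grid_proj_def intro!: SUP_least ennreal_leI)

text \<open>Keeping \<open>L\<close> and \<open>D\<close> abstract lets the same estimate serve
  first derivatives, second derivatives and, with the identity operator, undifferentiated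
  terms.\<close>

lemma discretizes_perturbed:
  assumes N: "grid_norm hs X N" and hs: "hs \<subseteq> {0<..}"
    and D: "discretizes K hs \<Omega> per X N D L r"
    and \<psi>: "smooth_fun \<Omega> per \<psi>" and \<epsilon>: "uniformly_smooth K hs \<Omega> per \<epsilon>"
  shows "eq_up_to_O hs N (\<lambda>h. D h (\<lambda>x. \<Pi> (X h) \<psi> x + h powr p * \<Pi> (X h) (\<epsilon> h) x))
    (\<lambda>h. \<Pi> (X h) (L \<psi>)) (min p r)"
proof -
  have lin: "grid_linear (X h) (D h)" if "h \<in> hs" for h
    using D that by (simp add: discretizes_def)
  have Dgrid: "D h v \<in> grid_funs (X h)" if "h \<in> hs" "v \<in> grid_funs (X h)" for h v
    using lin[OF that(1)] that(2) by (simp add: grid_linear_def)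
  have split: "D h (\<lambda>x. \<Pi> (X h) \<psi> x + h powr p * \<Pi> (X h) (\<epsilon> h) x) =
      (\<lambda>x. D h (\<Pi> (X h) \<psi>) x + h powr p * D h (\<Pi> (X h) (\<epsilon> h)) x)" if "h \<in> hs" for h
    by (rule grid_linear_combination[OF lin[OF that] grid_proj_in_grid_funs grid_proj_in_grid_funs])
  have main: "eq_up_to_O hs N (\<lambda>h. D h (\<Pi> (X h) \<psi>)) (\<lambda>h. \<Pi> (X h) (L \<psi>)) (min p r)"
  proof (rule eq_up_to_O_mono[OF hs])
    show "eq_up_to_O hs N (\<lambda>h. D h (\<Pi> (X h) \<psi>)) (\<lambda>h. \<Pi> (X h) (L \<psi>)) r"
      using D \<psi> by (simp add: discretizes_def consistent_def)
  qed simp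
  obtain C where C: "\<And>h. h \<in> hs \<Longrightarrow> N h (D h (\<Pi> (X h) (\<epsilon> h))) \<le> ennreal C"
  proof -
    have "\<exists>C. \<forall>h\<in>hs. N h (D h (\<Pi> (X h) (\<epsilon> h))) \<le> ennreal C"
      using D \<epsilon> by (simp add: discretizes_def stable_def)
    with that show thesis by blast
  qed
  \<comment> \<open>The stability constant is independent of \<open>h\<close>, so homogeneity of the
    norm leaves exactly the factor \<open>h powr p\<close>.\<close>
  have "N h (\<lambda>x. h powr p * D h (\<Pi> (X h) (\<epsilon> h)) x) \<le> ennreal (C * h powr p)" if "h \<in> hs" for h
  proof -
    have "N h (\<lambda>x. h powr p * D h (\<Pi> (X h) (\<epsilon> h)) x) = ennreal \<bar>h powr p\<bar> * N h (D h (\<Pi> (X h) (\<epsilon> h)))"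
      using Dgrid[OF that grid_proj_in_grid_funs] by (rule grid_norm_scale[OF N that])
    also have "\<dots> \<le> ennreal \<bar>h powr p\<bar> * ennreal C"
      using C[OF that] by (rule mult_left_mono) simp
    also have "\<dots> = ennreal (C * h powr p)"
      by (simp add: ennreal_mult' mult.commute[of C])
    finally show ?thesis .
  qed
  then have "eq_up_to_O hs N (\<lambda>h x. h powr p * D h (\<Pi> (X h) (\<epsilon> h)) x) (\<lambda>h x. 0) p"
    unfolding eq_up_to_O_def using hs by (intro exI[of _ C] eventually_at_within_small) auto
  then have remainder:
    "eq_up_to_O hs N (\<lambda>h x. h powr p * D h (\<Pi> (X h) (\<epsilon> h)) x) (\<lambda>h x. 0) (min p r)"
    by (rule eq_up_to_O_mono[OF hs]) simp
  have "eq_up_to_O hs N (\<lambda>h x. D h (\<Pi> (X h) \<psi>) x + h powr p * D h (\<Pi> (X h) (\<epsilon> h)) x)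
      (\<lambda>h x. \<Pi> (X h) (L \<psi>) x + 0) (min p r)"
  proof (rule eq_up_to_O_add[OF N hs main remainder])
    fix h assume "h \<in> hs"
    then show "(\<lambda>x. h powr p * D h (\<Pi> (X h) (\<epsilon> h)) x) \<in> grid_funs (X h)"
      using Dgrid[OF _ grid_proj_in_grid_funs] by (simp add: grid_funs_def)
  qed (simp_all add: grid_proj_in_grid_funs Dgrid, simp add: grid_funs_def)
  also have "?this \<longleftrightarrow> ?thesis"
    by (rule eq_up_to_O_cong[OF hs]) (simp_all add: split)
  finally show ?thesis .
qed

text \<open>Consistency is exact, so the order \<open>r\<close> is free. Stability needs just the
  order-0 bound, which every \<open>K\<close> includes, the inclusion of the grid in \<Omega>, where
  that bound holds, and the control of the grid norm by the maximum norm.\<close>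

lemma discretizes_identity:
  assumes N: "grid_norm hs X N" and hs: "hs \<subseteq> {0<..}" and X: "\<And>h. h \<in> hs \<Longrightarrow> X h \<subseteq> \<Omega>"
  shows "discretizes K hs \<Omega> per X N (\<lambda>h v. v) (\<lambda>\<psi>. \<psi>) r"
proof -
  have "stable K hs \<Omega> per X N (\<lambda>h v. v)"
    unfolding stable_def
  proof (intro allI impI)
    fix \<epsilon> :: "real \<Rightarrow> 'a \<Rightarrow> real"
    assume \<epsilon>: "uniformly_smooth K hs \<Omega> per \<epsilon>"
    have "bounded_derivs 0 hs \<Omega> \<epsilon>"
      using \<epsilon> by (simp add: uniformly_smooth_iff zero_enat_def[symmetric])
    then obtain C where C: "\<forall>h\<in>hs. \<forall>x\<in>\<Omega>. \<bar>\<epsilon> h x\<bar> \<le> C"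
      by (auto simp: bounded_derivs_0)
    obtain M where M: "\<forall>h\<in>hs. \<forall>v\<in>grid_funs (X h). N h v \<le> ennreal M * max_norm (X h) v"
      using N unfolding grid_norm_def by blast
    \<comment> \<open>\<open>M\<close> has no prescribed sign; one nonnegative factor suffices to
      merge the product inside \<open>ennreal\<close>.\<close>
    have "N h (\<Pi> (X h) (\<epsilon> h)) \<le> ennreal (\<bar>M\<bar> * C)" if "h \<in> hs" for h
    proof -
      have "N h (\<Pi> (X h) (\<epsilon> h)) \<le> ennreal M * max_norm (X h) (\<Pi> (X h) (\<epsilon> h))"
        using M that grid_proj_in_grid_funs by blast
      also have "\<dots> \<le> ennreal \<bar>M\<bar> * ennreal C"
        using C X that by (intro mult_mono max_norm_grid_proj_le ennreal_leI) auto
      finally show ?thesis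
        by (simp add: ennreal_mult')
    qed
    then show "\<exists>C. \<forall>h\<in>hs. N h (\<Pi> (X h) (\<epsilon> h)) \<le> ennreal C"
      by blast
  qed
  then show ?thesis
    unfolding discretizes_def consistent_def grid_linear_def
    by (simp add: eq_up_to_O_refl[OF N hs])
qed


section \<open>Temporal derivatives of the right-hand side\<close>

lemma grid_family_subset: "grid_family c hs \<Omega> X \<Longrightarrow> h \<in> hs \<Longrightarrow> X h \<subseteq> \<Omega>"
  unfolding grid_family_def by blast

lemma temporal_derivatives_order:
  fixes f :: "'a::euclidean_space \<Rightarrow> real \<Rightarrow> real"
  assumes grid: "grid_family c hs \<Omega> X" and N: "grid_norm hs X N"
    and u: "smooth_fun \<Omega> per u" and f: "\<forall>b\<in>Basis. smooth (f b)" and S: "smooth S"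
    and Hh: "has_error_expansion K hs \<Omega> per X Hh u (Hn f \<nu> S u) p"
    and D1: "\<forall>b\<in>Basis. discretizes K hs \<Omega> per X N (D1 b) (partial b) r1"
    and D2: "\<forall>b\<in>Basis. discretizes K hs \<Omega> per X N (D2 b) (partial b ^^ 2) r2"
  shows "eq_up_to_O hs N
        (\<lambda>h. Fn_dot_h (\<lambda>b. D1 b h) f (\<Pi> (X h) u) (Hh h (\<Pi> (X h) u)))
        (\<lambda>h. \<Pi> (X h) (Fn_dot f \<nu> S u)) (min p r1)" (is ?F)
    and "eq_up_to_O hs N
        (\<lambda>h. Gn_dot_h (\<lambda>b. D2 b h) \<nu> S (\<Pi> (X h) u) (Hh h (\<Pi> (X h) u)))
        (\<lambda>h. \<Pi> (X h) (Gn_dot f \<nu> S u)) (min p r2)" (is ?G)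
proof -
  define H where "H = Hn f \<nu> S u"
  define W where "W h = Hh h (\<Pi> (X h) u)" for h
  have hs: "hs \<subseteq> {0<..}"
    using grid by (simp add: grid_family_def)
  have H: "smooth_fun \<Omega> per H"
    unfolding H_def using u f S by (rule smooth_fun_Hn)
  obtain \<epsilon> where \<epsilon>: "uniformly_smooth K hs \<Omega> per \<epsilon>"
    and W: "\<And>h. h \<in> hs \<Longrightarrow> W h = (\<lambda>x. \<Pi> (X h) H x + h powr p * \<Pi> (X h) (\<epsilon> h) x)"
    using Hh unfolding has_error_expansion_def H_def W_def by blast
  have Wgrid: "W h \<in> grid_funs (X h)" if "h \<in> hs" for h
    using W[OF that] by (simp add: grid_proj_def grid_funs_def)
  \<comment> \<open>Off the grid the sample of \<open>u\<close> is 0, but \<open>deriv g 0\<close>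
    need not vanish; it is the factor \<open>W h\<close> that makes the product a grid
    function.\<close>
  have prodgrid: "(\<lambda>x. deriv g (\<Pi> (X h) u x) * W h x) \<in> grid_funs (X h)" if "h \<in> hs" for g h
    using Wgrid[OF that] by (simp add: grid_funs_def)
  \<comment> \<open>Stated for an arbitrary discretization: the flux uses it with
    \<open>D1 b\<close> for each direction, the reaction term with the identity.\<close>
  have prod: "eq_up_to_O hs N (\<lambda>h. D h (\<lambda>x. deriv g (\<Pi> (X h) u x) * W h x))
      (\<lambda>h. \<Pi> (X h) (L (\<lambda>x. deriv g (u x) * H x))) (min p r)"
    if D: "discretizes K hs \<Omega> per X N D L r" and g: "smooth g" for D L r g
  proof -
    have g': "smooth_fun \<Omega> per (\<lambda>x. deriv g (u x))"
      by (rule smooth_fun_compose[OF smooth_deriv[OF g] u])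
    have *: "(\<lambda>x. deriv g (\<Pi> (X h) u x) * W h x) =
        (\<lambda>x. \<Pi> (X h) (\<lambda>x. deriv g (u x) * H x) x + h powr p * \<Pi> (X h) (\<lambda>x. deriv g (u x) * \<epsilon> h x) x)"
      if "h \<in> hs" for h
      unfolding W[OF that] by (auto simp: grid_proj_def fun_eq_iff algebra_simps)
    have "eq_up_to_O hs N (\<lambda>h. D h (\<lambda>x. \<Pi> (X h) (\<lambda>x. deriv g (u x) * H x) x +
        h powr p * \<Pi> (X h) (\<lambda>x. deriv g (u x) * \<epsilon> h x) x))
        (\<lambda>h. \<Pi> (X h) (L (\<lambda>x. deriv g (u x) * H x))) (min p r)"
      using g' H \<epsilon>
      by (intro discretizes_perturbed[OF N hs D] smooth_fun_mult uniformly_smooth_mult uniformly_smooth_const_family)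
    also have "?this \<longleftrightarrow> ?thesis"
      by (intro eq_up_to_O_cong[OF hs]) (auto simp: *)
    finally show ?thesis .
  qed
  have D1grid: "D1 b h v \<in> grid_funs (X h)" if "b \<in> Basis" "h \<in> hs" "v \<in> grid_funs (X h)" for b h v
    using D1 that unfolding discretizes_def grid_linear_def by blast
  have D2grid: "D2 b h v \<in> grid_funs (X h)" if "b \<in> Basis" "h \<in> hs" "v \<in> grid_funs (X h)" for b h v
    using D2 that unfolding discretizes_def grid_linear_def by blast
  have sumgrid: "(\<lambda>x. \<Sum>b\<in>Basis. v b x) \<in> grid_funs Y"
    if "\<And>b. b \<in> Basis \<Longrightarrow> v b \<in> grid_funs Y" for v :: "'a \<Rightarrow> 'a \<Rightarrow> real" and Y
    using that by (simp add: grid_funs_def)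

  \<comment> \<open>The minus sign is treated as scaling by -1, and the right-hand side is a sum of
    samples because each direction is estimated separately; it equals the sample of the sum.\<close>
  have "eq_up_to_O hs N
      (\<lambda>h x. -1 * (\<Sum>b\<in>Basis. D1 b h (\<lambda>y. deriv (f b) (\<Pi> (X h) u y) * W h y) x))
      (\<lambda>h x. -1 * (\<Sum>b\<in>Basis. \<Pi> (X h) (partial b (\<lambda>y. deriv (f b) (u y) * H y)) x)) (min p r1)"
    using D1 f
    by (intro eq_up_to_O_scale[OF N hs] eq_up_to_O_sum[OF N hs] prod sumgrid D1grid prodgrid
        grid_proj_in_grid_funs) auto
  also have "?this \<longleftrightarrow> ?F"
    by (intro eq_up_to_O_cong[OF hs])
      (auto simp: Fn_dot_h_def Fn_dot_def W_def H_def grid_proj_def fun_eq_iff)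
  finally show ?F .

  \<comment> \<open>Diffusion carries no variable coefficient, so the expansion of \<open>W\<close>
    itself is inserted.\<close>
  have "eq_up_to_O hs N (\<lambda>h. D2 b h (W h)) (\<lambda>h. \<Pi> (X h) ((partial b ^^ 2) H)) (min p r2)"
    if "b \<in> Basis" for b
  proof -
    have "eq_up_to_O hs N (\<lambda>h. D2 b h (\<lambda>x. \<Pi> (X h) H x + h powr p * \<Pi> (X h) (\<epsilon> h) x))
        (\<lambda>h. \<Pi> (X h) ((partial b ^^ 2) H)) (min p r2)"
      using D2 H \<epsilon> that by (intro discretizes_perturbed[OF N hs]) auto
    also have "?this \<longleftrightarrow> ?thesis"
      by (intro eq_up_to_O_cong[OF hs]) (auto simp: W)
    finally show ?thesis .
  qed
  then have diffusion: "eq_up_to_O hs N (\<lambda>h x. \<nu> * (\<Sum>b\<in>Basis. D2 b h (W h) x))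
      (\<lambda>h x. \<nu> * (\<Sum>b\<in>Basis. \<Pi> (X h) ((partial b ^^ 2) H) x)) (min p r2)"
    by (intro eq_up_to_O_scale[OF N hs] eq_up_to_O_sum[OF N hs] sumgrid D2grid Wgrid
        grid_proj_in_grid_funs) auto
  \<comment> \<open>The identity has every order; taking \<open>r2\<close> gives the same exponent
    as for diffusion, so that the two estimates can be added.\<close>
  have reaction: "eq_up_to_O hs N (\<lambda>h x. deriv S (\<Pi> (X h) u x) * W h x)
      (\<lambda>h. \<Pi> (X h) (\<lambda>x. deriv S (u x) * H x)) (min p r2)"
    using S grid by (intro prod[OF discretizes_identity[OF N hs]] grid_family_subset)
  have "eq_up_to_O hs N
      (\<lambda>h x. \<nu> * (\<Sum>b\<in>Basis. D2 b h (W h) x) + deriv S (\<Pi> (X h) u x) * W h x)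
      (\<lambda>h x. \<nu> * (\<Sum>b\<in>Basis. \<Pi> (X h) ((partial b ^^ 2) H) x) + \<Pi> (X h) (\<lambda>x. deriv S (u x) * H x) x)
      (min p r2)"
  proof (rule eq_up_to_O_add[OF N hs diffusion reaction])
    fix h assume h: "h \<in> hs"
    show "(\<lambda>x. \<nu> * (\<Sum>b\<in>Basis. D2 b h (W h) x)) \<in> grid_funs (X h)"
      using sumgrid[OF D2grid[OF _ h Wgrid[OF h]]] by (simp add: grid_funs_def)
    show "(\<lambda>x. \<nu> * (\<Sum>b\<in>Basis. \<Pi> (X h) ((partial b ^^ 2) H) x)) \<in> grid_funs (X h)"
      by (simp add: grid_funs_def grid_proj_def)
  qed (auto intro: prodgrid grid_proj_in_grid_funs)
  also have "?this \<longleftrightarrow> ?G"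
    by (intro eq_up_to_O_cong[OF hs])
      (auto simp: Gn_dot_h_def Gn_dot_def W_def H_def grid_proj_def fun_eq_iff)
  finally show ?G .
qed

section \<open>The line as a one-dimensional Euclidean space\<close>

lemma partial_1: "partial (1 :: real) = deriv"
  by (rule ext) (rule partial_real)

text \<open>Sums over \<open>Basis\<close> have the single term 1, and the derivative along it is
  \<open>deriv\<close>. The equation for \<open>H1\<close> comes first because both dotted
  quantities contain it.\<close>

lemma one_dimension_eqs:
  "H1 f \<nu> S u = Hn (\<lambda>_. f) \<nu> S u"
  "F1_dot f \<nu> S u = Fn_dot (\<lambda>_. f) \<nu> S u"
  "G1_dot f \<nu> S u = Gn_dot (\<lambda>_. f) \<nu> S u"
  "F1_dot_h D f U W = Fn_dot_h (\<lambda>_. D) (\<lambda>_. f) U W"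
  "G1_dot_h D \<nu> S U W = Gn_dot_h (\<lambda>_. D) \<nu> S U W"
proof -
  show H: "H1 f \<nu> S u = Hn (\<lambda>_. f) \<nu> S u"
    by (simp add: H1_def F1_def G1_def Hn_def Fn_def Gn_def partial_1)
  show "F1_dot f \<nu> S u = Fn_dot (\<lambda>_. f) \<nu> S u"
    by (simp add: F1_dot_def Fn_dot_def H partial_1)
  show "G1_dot f \<nu> S u = Gn_dot (\<lambda>_. f) \<nu> S u"
    by (simp add: G1_dot_def Gn_dot_def H partial_1)
qed (simp_all add: F1_dot_h_def G1_dot_h_def Fn_dot_h_def Gn_dot_h_def)

theorem proposition3p1:
  fixes \<nu> p r1 r2 :: real
    and S :: "real \<Rightarrow> real"
    and K :: enat
    and hs :: "real set"
    (* one space dimension *)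
    and \<Omega> per :: "real set"
    and X :: "real \<Rightarrow> real set"
    and N :: "real \<Rightarrow> (real \<Rightarrow> real) \<Rightarrow> ennreal"
    and f u :: "real \<Rightarrow> real"
    and Hh D1 D2 :: "real \<Rightarrow> (real \<Rightarrow> real) \<Rightarrow> real \<Rightarrow> real"
    (* several space dimensions *)
    and c :: "'a::euclidean_space \<Rightarrow> real"
    and \<Omega>' per' :: "'a set"
    and X' :: "real \<Rightarrow> 'a set"
    and N' :: "real \<Rightarrow> ('a \<Rightarrow> real) \<Rightarrow> ennreal"
    and f' :: "'a \<Rightarrow> real \<Rightarrow> real"
    and u' :: "'a \<Rightarrow> real"
    and Hh' :: "real \<Rightarrow> ('a \<Rightarrow> real) \<Rightarrow> 'a \<Rightarrow> real"
    and D1' D2' :: "'a \<Rightarrow> real \<Rightarrow> ('a \<Rightarrow> real) \<Rightarrow> 'a \<Rightarrow> real"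
  shows
    "(grid_family (\<lambda>_. 1) hs \<Omega> X \<and> grid_norm hs X N \<and>
      smooth_fun \<Omega> per u \<and> smooth f \<and> smooth S \<and>
      has_error_expansion K hs \<Omega> per X Hh u (H1 f \<nu> S u) p \<and>
      discretizes K hs \<Omega> per X N D1 deriv r1 \<and>
      discretizes K hs \<Omega> per X N D2 (deriv ^^ 2) r2
      \<longrightarrow>
      eq_up_to_O hs N
        (\<lambda>h. F1_dot_h (D1 h) f (\<Pi> (X h) u) (Hh h (\<Pi> (X h) u)))
        (\<lambda>h. \<Pi> (X h) (F1_dot f \<nu> S u)) (min p r1) \<and>
      eq_up_to_O hs N
        (\<lambda>h. G1_dot_h (D2 h) \<nu> S (\<Pi> (X h) u) (Hh h (\<Pi> (X h) u)))
        (\<lambda>h. \<Pi> (X h) (G1_dot f \<nu> S u)) (min p r2))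
     \<and>
     (grid_family c hs \<Omega>' X' \<and> grid_norm hs X' N' \<and>
      smooth_fun \<Omega>' per' u' \<and> (\<forall>b\<in>Basis. smooth (f' b)) \<and> smooth S \<and>
      has_error_expansion K hs \<Omega>' per' X' Hh' u' (Hn f' \<nu> S u') p \<and>
      (\<forall>b\<in>Basis. discretizes K hs \<Omega>' per' X' N' (D1' b) (partial b) r1) \<and>
      (\<forall>b\<in>Basis. discretizes K hs \<Omega>' per' X' N' (D2' b) (partial b ^^ 2) r2)
      \<longrightarrow>
      eq_up_to_O hs N'
        (\<lambda>h. Fn_dot_h (\<lambda>b. D1' b h) f' (\<Pi> (X' h) u') (Hh' h (\<Pi> (X' h) u')))
        (\<lambda>h. \<Pi> (X' h) (Fn_dot f' \<nu> S u')) (min p r1) \<and>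
      eq_up_to_O hs N'
        (\<lambda>h. Gn_dot_h (\<lambda>b. D2' b h) \<nu> S (\<Pi> (X' h) u') (Hh' h (\<Pi> (X' h) u')))
        (\<lambda>h. \<Pi> (X' h) (Gn_dot f' \<nu> S u')) (min p r2))"
proof ((intro conjI impI; elim conjE), goal_cases)
  case 1
  \<comment> \<open>Constant families such as \<open>\<lambda>_. f\<close> and
    \<open>\<lambda>_. D1\<close> play the part of the direction-indexed data, with spacing factor
    1.\<close>
  then show ?case
    unfolding one_dimension_eqs
    by (intro temporal_derivatives_order(1)[of "\<lambda>_. 1" hs \<Omega> X N per u "\<lambda>_. f" S K Hh \<nu> p "\<lambda>_. D1" r1 "\<lambda>_. D2" r2])
      (simp_all add: partial_1)
next
  case 2
  then show ?case
    unfolding one_dimension_eqs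
    by (intro temporal_derivatives_order(2)[of "\<lambda>_. 1" hs \<Omega> X N per u "\<lambda>_. f" S K Hh \<nu> p "\<lambda>_. D1" r1 "\<lambda>_. D2" r2])
      (simp_all add: partial_1)
next
  case 3
  then show ?case
    by (intro temporal_derivatives_order(1)[of c hs \<Omega>' X' N' per' u' f' S K Hh' \<nu> p D1' r1 D2' r2])
next
  case 4
  then show ?case
    by (intro temporal_derivatives_order(2)[of c hs \<Omega>' X' N' per' u' f' S K Hh' \<nu> p D1' r1 D2' r2])
qed

end
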